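(* Let $X$ be a dyadic compactum such that $\pi\chi(p,X)=w(X)$ for all $p\in X$. Then every base $\mathcal{A}$ of $X$ contains a subset that is an $\omega^{\mathrm{op}}$-like base of $X$.
   Context: A dyadic compactum is a Hausdorff continuous image of $2^\kappa$ for some cardinal $\kappa$. $\pi\chi(p,X)$ is the $\pi$-character of $p$ and $w(X)$ the weight of $X$. Families of open sets are ordered by inclusion; a family is $\omega^{\mathrm{op}}$-like if each member is contained in only finitely many members. *)

theory Defs
  imports "HOL-Analysis.Analysis"
begin

definition is_base :: "'a topology \<Rightarrow> 'a set set \<Rightarrow> bool" where
  "is_base X \<B> \<longleftrightarrow> openin X = arbitrary union_of (\<lambda>V. V \<in> \<B>)"

definition local_pi_base :: "'a topology \<Rightarrow> 'a \<Rightarrow> 'a set set \<Rightarrow> bool" where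
  "local_pi_base X p \<P> \<longleftrightarrow>
     (\<forall>V\<in>\<P>. openin X V \<and> V \<noteq> {}) \<and>
     (\<forall>U. openin X U \<and> p \<in> U \<longrightarrow> (\<exists>V\<in>\<P>. V \<subseteq> U))"

definition weight :: "'a topology \<Rightarrow> 'a set rel" where
  "weight X = card_of (SOME \<B>. is_base X \<B> \<and>
      (\<forall>\<B>'. is_base X \<B>' \<longrightarrow> ordLeq2 (card_of \<B>) (card_of \<B>')))"

definition pi_char :: "'a \<Rightarrow> 'a topology \<Rightarrow> 'a set rel" where
  "pi_char p X = card_of (SOME \<P>. local_pi_base X p \<P> \<and>
      (\<forall>\<P>'. local_pi_base X p \<P>' \<longrightarrow> ordLeq2 (card_of \<P>) (card_of \<P>')))"

definition cantor_cube :: "'i set \<Rightarrow> ('i \<Rightarrow> bool) topology" where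
  "cantor_cube I = product_topology (\<lambda>_. discrete_topology (UNIV :: bool set)) I"

text \<open>Dyadic compactum: Hausdorff continuous image of 2^I, for some index set I of type 'i.
  Universal quantification over the type 'i at the theorem level makes this faithful.\<close>
definition dyadic_compactum :: "'i itself \<Rightarrow> 'a topology \<Rightarrow> bool" where
  "dyadic_compactum _ X \<longleftrightarrow> Hausdorff_space X \<and>
     (\<exists>(I::'i set) f. continuous_map (cantor_cube I) X f \<and>
        f ` topspace (cantor_cube I) = topspace X)"

definition omega_op_like :: "'a set set \<Rightarrow> bool" where
  "omega_op_like \<B> \<longleftrightarrow> (\<forall>U\<in>\<B>. finite {V\<in>\<B>. U \<subseteq> V})"

end

theory Submission
  imports Defs
begin

unbundle cardinal_syntax

text \<open>
  Let \<open>f\<close> map the Cantor cube \<open>2\<^sup>I\<close> onto \<open>X\<close>, and let \<open>\<kappa>\<close> be the (infinite) weight of \<open>X\<close>.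
  Well-order in type \<open>\<kappa>\<close> the pairs \<open>(P, Q)\<close> of members of a smallest base. At the stage of a
  pair with \<open>closure P \<subseteq> Q\<close>, cover \<open>closure P\<close> by finitely many \<open>U \<in> \<A>\<close>, each with an open
  \<open>H \<subseteq> Q\<close> around its closure that contains none of the sets \<open>int (f E)\<close> for cylinders \<open>E\<close>
  supported on the finite set of coordinates of an earlier stage. This is possible, as these
  are fewer than \<open>\<kappa>\<close> open sets and hence form no local \<open>\<pi>\<close>-base. By compactness there is a
  finite set \<open>s\<close> of coordinates such that \<open>f x \<in> U\<close> implies \<open>f y \<in> H\<close> whenever \<open>x\<close> and \<open>y\<close> agree
  on \<open>s\<close>; this \<open>s\<close> is the set of coordinates of the stage.

  The sets \<open>U\<close> form a base. Every nonempty open set contains some \<open>f E\<close> with nonempty interior,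
  where \<open>E\<close> is a cylinder supported on a finite set \<open>t\<close>. If it is contained in a set \<open>U\<close> of a stage
  with coordinates \<open>s\<close>, then the cylinder obtained from \<open>E\<close> by forgetting the coordinates outside
  \<open>t \<inter> s\<close> has its image inside \<open>H\<close>, so this cylinder is not supported on an earlier stage. Hence
  \<open>t \<inter> s\<close> determines the stage, and only finitely many stages occur.
\<close>

section \<open>Bases, weight and \<pi>-character\<close>

lemma is_base_iff:
  "is_base X \<B> \<longleftrightarrow>
     (\<forall>V\<in>\<B>. openin X V) \<and> (\<forall>U x. openin X U \<and> x \<in> U \<longrightarrow> (\<exists>V\<in>\<B>. x \<in> V \<and> V \<subseteq> U))"
  unfolding is_base_def openin_topology_base_unique by blast

text \<open>Cardinals are well-ordered, so the \<open>SOME\<close> in \<open>weight\<close> and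
  \<open>pi_char\<close> picks a genuine minimiser.\<close>

lemma exists_card_minimal:
  assumes "P (A :: 'b set)"
  shows "\<exists>B. P B \<and> (\<forall>B'. P B' \<longrightarrow> |B| \<le>o |B'| )"
  using exists_minim_Card_order[of "card_of ` Collect P"] assms
  by (auto simp: card_of_Card_order)

lemma weight_attained:
  obtains \<B> where "is_base X \<B>" "weight X = |\<B>|"
proof -
  have "is_base X (Collect (openin X))"
    by (auto simp: is_base_iff)
  from someI_ex[OF exists_card_minimal[of "is_base X", OF this]] show thesis
    using that unfolding weight_def by blast
qed

lemma pi_char_le:
  assumes "local_pi_base X p \<P>"
  shows "pi_char p X \<le>o |\<P>|"
  using someI_ex[OF exists_card_minimal[of "local_pi_base X p", OF assms]] assms
  unfolding pi_char_def by blast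

text \<open>Bounds the number of cylinders used up before a stage. For finite \<open>J\<close> the
  union is finite; for infinite \<open>J\<close> it has size at most \<open>|J|\<close>.\<close>

lemma UN_finite_ordLess:
  assumes "infinite B" "|J| <o |B|" "\<And>j. j \<in> J \<Longrightarrow> finite (D j)"
  shows "|\<Union>j\<in>J. D j| <o |B|"
proof (cases "finite J")
  case True
  then have "finite (\<Union>j\<in>J. D j)" using assms(3) by blast
  then show ?thesis
    using assms(1) by (intro finite_ordLess_infinite) (auto simp: card_of_well_order_on Field_card_of)
next
  case False
  have "|D j| \<le>o |J|" if "j \<in> J" for j
    using assms(3)[OF that] False
    by (intro ordLess_imp_ordLeq finite_ordLess_infinite)
      (auto simp: card_of_well_order_on Field_card_of)
  then have "|\<Union>j\<in>J. D j| \<le>o |J|"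
    using card_of_UNION_ordLeq_infinite[OF False ordLeq_refl[OF card_of_Card_order]] by blast
  then show ?thesis using assms(2) ordLeq_ordLess_trans by blast
qed

text \<open>Used contrapositively: if finitely many closed sets cover a nonempty open set, one of
  them has nonempty interior.\<close>

lemma interior_of_Union_closed_empty:
  assumes "finite \<F>" "\<And>S. S \<in> \<F> \<Longrightarrow> closedin X S" "\<And>S. S \<in> \<F> \<Longrightarrow> X interior_of S = {}"
  shows "X interior_of (\<Union>\<F>) = {}"
  using assms
proof (induction rule: finite_induct)
  case (insert S \<F>)
  then show ?case
    using interior_of_closedin_union_empty_interior_of[of X S "\<Union>\<F>"] by simp
qed simp

text \<open>A finite base gives \<open>p\<close> a least open neighbourhood, which alone is a local
  \<pi>-base. So the \<pi>-character, and with it the weight, is at most 1.\<close>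

lemma trivial_if_finite_weight:
  assumes \<B>: "is_base X \<B>" "weight X = |\<B>|" "finite \<B>"
    and p: "p \<in> topspace X" "pi_char p X =o weight X"
    and U: "openin X U" "U \<noteq> {}"
  shows "U = topspace X"
proof -
  \<comment> \<open>Intersecting with \<open>topspace X\<close> gives the right value when the
    family is empty and its \<open>\<Inter>\<close> is \<open>UNIV\<close>.\<close>
  define M where "M = topspace X \<inter> \<Inter>{B \<in> \<B>. p \<in> B}"
  have op: "openin X B" if "B \<in> \<B>" for B
    using \<B> that by (auto simp: is_base_iff)
  have "openin X M"
  proof (cases "{B \<in> \<B>. p \<in> B} = {}")
    case False
    then have "openin X (\<Inter>{B \<in> \<B>. p \<in> B})"
      using \<B>(3) op by (intro openin_Inter) auto
    then show ?thesis unfolding M_def by blast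
  next
    case True
    show ?thesis unfolding M_def True by simp
  qed
  moreover have "p \<in> M" using p by (auto simp: M_def)
  moreover have "M \<subseteq> V" if "openin X V" "p \<in> V" for V
    using \<B>(1) that unfolding is_base_iff M_def by blast
  ultimately have "local_pi_base X p {M}"
    unfolding local_pi_base_def by blast
  then have "|\<B>| \<le>o |{M}|"
    using pi_char_le p(2) \<B>(2) ordIso_ordLeq_trans ordIso_symmetric by metis
  then have "card \<B> \<le> 1"
    using \<B>(3) by (metis card_of_ordLeq card_inj_on_le finite.emptyI finite_insert is_singletonI is_singleton_altdef)
  \<comment> \<open>The only base member lies inside \<open>U\<close> and must also contain every
    point of the space.\<close>
  moreover have "\<exists>B\<in>\<B>. B \<subseteq> U" "\<exists>B\<in>\<B>. p \<in> B"
    using \<B>(1) p(1) U openin_topspace[of X] unfolding is_base_iff by blast+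
  moreover have "\<exists>B\<in>\<B>. x \<in> B \<and> B \<subseteq> U" if "x \<in> U" for x
    using \<B>(1) that U unfolding is_base_iff by blast
  moreover have "\<exists>B\<in>\<B>. x \<in> B" if "x \<in> topspace X" for x
    using \<B>(1) that openin_topspace[of X] unfolding is_base_iff by blast
  ultimately show ?thesis
    using \<B>(3) openin_subset[OF U(1)] card_le_Suc0_iff_eq[OF \<B>(3)] U(2)
    by (metis One_nat_def equals0I subset_antisym subset_eq)
qed

section \<open>Cylinders in the Cantor cube\<close>

definition cylinder :: "'i set \<Rightarrow> 'i set \<Rightarrow> ('i \<Rightarrow> bool) \<Rightarrow> ('i \<Rightarrow> bool) set" where
  "cylinder I t x = {y \<in> topspace (cantor_cube I). \<forall>i\<in>t. y i = x i}"

lemma topspace_cantor_cube: "topspace (cantor_cube I) = (\<Pi>\<^sub>E i\<in>I. UNIV)"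
  by (simp add: cantor_cube_def)

lemma compact_space_cantor_cube: "compact_space (cantor_cube I)"
  unfolding cantor_cube_def
  by (simp add: compact_space_product_topology compact_space_discrete_topology)

lemma cylinder_eq_PiE:
  assumes "t \<subseteq> I"
  shows "cylinder I t x = (\<Pi>\<^sub>E i\<in>I. if i \<in> t then {x i} else UNIV)"
proof (intro set_eqI)
  fix y
  have "(\<forall>i\<in>t. y i = x i) \<longleftrightarrow> (\<forall>i\<in>I. y i \<in> (if i \<in> t then {x i} else UNIV))"
    using assms by (simp split: if_split) blast
  then show "y \<in> cylinder I t x \<longleftrightarrow> y \<in> (\<Pi>\<^sub>E i\<in>I. if i \<in> t then {x i} else UNIV)"
    unfolding cylinder_def topspace_cantor_cube PiE_iff by auto
qed

lemma openin_cylinder: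
  assumes "finite t" "t \<subseteq> I"
  shows "openin (cantor_cube I) (cylinder I t x)"
  unfolding cylinder_eq_PiE[OF assms(2)] cantor_cube_def
  using assms(1) by (auto simp: openin_PiE_gen intro: finite_subset[rotated])

lemma closedin_cylinder:
  assumes "t \<subseteq> I"
  shows "closedin (cantor_cube I) (cylinder I t x)"
  unfolding cylinder_eq_PiE[OF assms] cantor_cube_def
  by (simp add: closedin_product_topology)

lemma cylinder_nhd:
  assumes "openin (cantor_cube I) W" "x \<in> W"
  obtains t where "finite t" "t \<subseteq> I" "x \<in> cylinder I t x" "cylinder I t x \<subseteq> W"
proof -
  obtain V where V: "finite {i \<in> I. V i \<noteq> UNIV}" "x \<in> Pi\<^sub>E I V" "Pi\<^sub>E I V \<subseteq> W"
    using assms unfolding cantor_cube_def openin_product_topology_alt by fastforce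
  let ?t = "{i \<in> I. V i \<noteq> UNIV}"
  have "cylinder I ?t x \<subseteq> Pi\<^sub>E I V"
  proof
    fix y assume y: "y \<in> cylinder I ?t x"
    have "y i \<in> V i" if "i \<in> I" for i
      using y V(2) that by (cases "V i = UNIV") (auto simp: cylinder_def PiE_iff)
    then show "y \<in> Pi\<^sub>E I V"
      using y by (auto simp: cylinder_def topspace_cantor_cube PiE_iff)
  qed
  moreover have "x \<in> cylinder I ?t x"
    using assms openin_subset by (auto simp: cylinder_def)
  ultimately show thesis using that[of ?t] V by blast
qed

definition cylinders :: "'i set \<Rightarrow> 'i set \<Rightarrow> ('i \<Rightarrow> bool) set set" where
  "cylinders I s = {cylinder I t x |t x. t \<subseteq> s}"

lemma finite_cylinders:
  assumes "finite s"
  shows "finite (cylinders I s)"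
proof -
  have "cylinders I s \<subseteq> (\<lambda>(t, x). cylinder I t x) ` (SIGMA t:Pow s. \<Pi>\<^sub>E i\<in>t. UNIV)"
  proof
    fix E assume "E \<in> cylinders I s"
    then obtain t x where "t \<subseteq> s" and E: "E = cylinder I t x"
      by (auto simp: cylinders_def)
    \<comment> \<open>Only the values of \<open>x\<close> on \<open>t\<close> matter, which leaves
      finitely many choices.\<close>
    moreover have "E = cylinder I t (restrict x t)"
      by (simp add: E cylinder_def)
    ultimately show "E \<in> (\<lambda>(t, x). cylinder I t x) ` (SIGMA t:Pow s. \<Pi>\<^sub>E i\<in>t. UNIV)"
      by (intro image_eqI[where x = "(t, restrict x t)"]) auto
  qed
  moreover have "finite (SIGMA t:Pow s. \<Pi>\<^sub>E i\<in>t. (UNIV :: bool set))"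
    using assms by (intro finite_SigmaI finite_PiE) (auto intro: finite_subset)
  ultimately show ?thesis by (meson finite_imageI finite_subset)
qed

section \<open>Hausdorff continuous images of the cube\<close>

locale cantor_cube_image =
  fixes X :: "'a topology" and I :: "'i set" and f :: "('i \<Rightarrow> bool) \<Rightarrow> 'a"
  assumes Hausdorff: "Hausdorff_space X"
    and continuous: "continuous_map (cantor_cube I) X f"
    and onto: "f ` topspace (cantor_cube I) = topspace X"
begin

lemma compact: "compact_space X"
  using image_compactin[OF _ continuous, of "topspace (cantor_cube I)"]
    compact_space_cantor_cube[of I]
  by (simp add: compact_space_def onto)

lemma nhd_closed:
  assumes "openin X W" "p \<in> W"
  obtains U where "openin X U" "p \<in> U" "X closure_of U \<subseteq> W"
proof -
  have "regular_space X"
    using compact Hausdorff by (rule compact_Hausdorff_imp_regular_space)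
  then obtain U K where U: "openin X U" "closedin X K" "p \<in> U" "U \<subseteq> K" "K \<subseteq> W"
    using assms unfolding neighbourhood_base_of_closedin[symmetric] neighbourhood_base_of by metis
  show thesis
    by (rule that[OF U(1,3) subset_trans[OF closure_of_minimal[OF U(4,2)] U(5)]])
qed

lemma closed_image_cylinder:
  assumes "t \<subseteq> I"
  shows "closedin X (f ` cylinder I t x)"
  by (intro compactin_imp_closedin[OF Hausdorff] image_compactin[OF _ continuous]
      closedin_compact_space[OF compact_space_cantor_cube] closedin_cylinder assms)

section \<open>Separation by finitely many coordinates\<close>

definition separating :: "'i set \<Rightarrow> 'a set \<Rightarrow> 'a set \<Rightarrow> bool" where
  "separating s U H \<longleftrightarrow>
     (\<forall>x\<in>topspace (cantor_cube I). \<forall>y\<in>topspace (cantor_cube I).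
        f x \<in> U \<and> (\<forall>i\<in>s. x i = y i) \<longrightarrow> f y \<in> H)"

lemma separating_mono: "separating s U H \<Longrightarrow> s \<subseteq> s' \<Longrightarrow> U' \<subseteq> U \<Longrightarrow> separating s' U' H"
  unfolding separating_def by blast

text \<open>The preimage of \<open>K\<close> is compact, so finitely many cylinders with image in
  \<open>H\<close> cover it; \<open>s\<close> collects their coordinates. Changing a point off
  \<open>s\<close> keeps it in its cylinder.\<close>

lemma finite_separating:
  assumes "closedin X K" "openin X H" "K \<subseteq> H"
  obtains s where "finite s" "s \<subseteq> I" "separating s K H"
proof -
  let ?C = "topspace (cantor_cube I)"
  let ?K = "{x \<in> ?C. f x \<in> K}"
  define good where "good = {(t, x). finite t \<and> t \<subseteq> I \<and> f ` cylinder I t x \<subseteq> H}"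
  have "closedin (cantor_cube I) ?K"
    using continuous assms(1) by (rule closedin_continuous_map_preimage)
  then have "compactin (cantor_cube I) ?K"
    using compact_space_cantor_cube closedin_compact_space by blast
  moreover have "?K \<subseteq> (\<Union>(t, x)\<in>good. cylinder I t x)"
  proof
    fix x assume x: "x \<in> ?K"
    moreover have "openin (cantor_cube I) {x \<in> ?C. f x \<in> H}"
      using continuous assms(2) by (rule openin_continuous_map_preimage)
    ultimately obtain t where "finite t" "t \<subseteq> I" "x \<in> cylinder I t x"
        "cylinder I t x \<subseteq> {x \<in> ?C. f x \<in> H}"
      using assms(3) by (elim cylinder_nhd) auto
    then show "x \<in> (\<Union>(t, x)\<in>good. cylinder I t x)"
      unfolding good_def by blast
  qed
  moreover have "openin (cantor_cube I) E" if "E \<in> (\<lambda>(t, x). cylinder I t x) ` good" for E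
    using that by (auto simp: good_def openin_cylinder)
  ultimately obtain \<F> where \<F>: "finite \<F>" "\<F> \<subseteq> (\<lambda>(t, x). cylinder I t x) ` good" "?K \<subseteq> \<Union>\<F>"
    using compactinD[of "cantor_cube I" ?K "(\<lambda>(t, x). cylinder I t x) ` good"] by blast
  obtain G where G: "G \<subseteq> good" "finite G" and "\<F> = (\<lambda>(t, x). cylinder I t x) ` G"
    using finite_subset_image[OF \<F>(1,2)] by (elim exE conjE)
  then have G_cover: "?K \<subseteq> (\<Union>(t, x)\<in>G. cylinder I t x)"
    using \<F>(3) by simp
  define s where "s = \<Union>(fst ` G)"
  have "separating s K H"
    unfolding separating_def
  proof (intro ballI impI)
    fix x y assume xy: "x \<in> ?C" "y \<in> ?C" "f x \<in> K \<and> (\<forall>i\<in>s. x i = y i)"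
    then obtain t z where tz: "(t, z) \<in> G" "x \<in> cylinder I t z"
      using G_cover by blast
    have "t \<subseteq> s" using tz(1) unfolding s_def by force
    then have "y \<in> cylinder I t z"
      using xy tz(2) by (auto simp: cylinder_def)
    then show "f y \<in> H" using tz(1) G(1) by (auto simp: good_def)
  qed
  moreover have "finite s" "s \<subseteq> I"
    using G by (fastforce simp: s_def good_def)+
  ultimately show thesis using that by blast
qed

lemma image_cylinder_Int_subset:
  assumes "separating s U H" "t \<subseteq> I" "f ` cylinder I t x \<subseteq> U"
  shows "f ` cylinder I (t \<inter> s) x \<subseteq> H"
proof clarify
  fix z assume z: "z \<in> cylinder I (t \<inter> s) x"
  \<comment> \<open>\<open>?y\<close> agrees with \<open>x\<close> on \<open>t\<close>, so its image
    is in \<open>U\<close>. It agrees with \<open>z\<close> on \<open>s\<close>, since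
    \<open>z\<close> agrees with \<open>x\<close> on \<open>t \<inter> s\<close>.\<close>
  let ?y = "\<lambda>i. if i \<in> t then x i else z i"
  have y: "?y \<in> cylinder I t x"
    using z assms(2) by (auto simp: cylinder_def topspace_cantor_cube PiE_iff extensional_def)
  then have "f ?y \<in> U" using assms(3) by blast
  then show "f z \<in> H"
    using assms(1) y z unfolding separating_def cylinder_def by force
qed

text \<open>For a suitable finite \<open>s\<close>, the finitely many cylinders fixing all of
  \<open>s\<close> and meeting the preimage of \<open>V\<close> have closed images that cover
  \<open>V\<close>, so one image has interior. Separation keeps it inside \<open>U\<close>.\<close>

lemma image_cylinder_with_interior:
  assumes "openin X U" "U \<noteq> {}"
  obtains t x where "finite t" "t \<subseteq> I" "f ` cylinder I t x \<subseteq> U"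
    "X interior_of (f ` cylinder I t x) \<noteq> {}"
proof -
  obtain p where p: "p \<in> U" using assms(2) by blast
  obtain V where V: "openin X V" "p \<in> V" "X closure_of V \<subseteq> U"
    using nhd_closed[OF assms(1) p] .
  obtain s where s: "finite s" "s \<subseteq> I" "separating s (X closure_of V) U"
    using finite_separating[OF closedin_closure_of assms(1) V(3)] .
  define \<F> where "\<F> = {f ` cylinder I s x |x. x \<in> topspace (cantor_cube I) \<and> f x \<in> V}"
  have VK: "V \<subseteq> X closure_of V"
    using V(1) by (simp add: closure_of_subset openin_subset)
  have "V \<subseteq> \<Union>\<F>"
  proof
    fix q assume "q \<in> V"
    then obtain x where "x \<in> topspace (cantor_cube I)" "q = f x"
      using V(1) onto openin_subset by blast
    then show "q \<in> \<Union>\<F>"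
      using \<open>q \<in> V\<close> by (auto simp: \<F>_def cylinder_def)
  qed
  then have "X interior_of (\<Union>\<F>) \<noteq> {}"
    using V(1,2) interior_of_maximal by blast
  moreover have "finite \<F>"
  proof (rule finite_subset)
    show "\<F> \<subseteq> (`) f ` cylinders I s" by (auto simp: \<F>_def cylinders_def)
  qed (simp add: finite_cylinders s(1))
  moreover have "closedin X S" if "S \<in> \<F>" for S
    using that s(2) by (auto simp: \<F>_def closed_image_cylinder)
  ultimately obtain S where "S \<in> \<F>" "X interior_of S \<noteq> {}"
    using interior_of_Union_closed_empty by blast
  then obtain x where x: "x \<in> topspace (cantor_cube I)" "f x \<in> V"
      "X interior_of (f ` cylinder I s x) \<noteq> {}"
    by (auto simp: \<F>_def)
  moreover have "f ` cylinder I s x \<subseteq> U"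
    using s(3) x VK unfolding separating_def cylinder_def by force
  ultimately show thesis using that s by blast
qed

text \<open>Empty interiors are exempt because they lie in every \<open>H\<close>.\<close>

definition avoiding :: "('i \<Rightarrow> bool) set set \<Rightarrow> 'a set \<Rightarrow> bool" where
  "avoiding \<E> H \<longleftrightarrow> (\<forall>E\<in>\<E>. X interior_of (f ` E) \<noteq> {} \<longrightarrow> \<not> X interior_of (f ` E) \<subseteq> H)"

lemma avoiding_nhd:
  assumes "|\<E>| <o pi_char p X" "openin X Q" "p \<in> Q"
  obtains H where "openin X H" "p \<in> H" "H \<subseteq> Q" "avoiding \<E> H"
proof -
  define \<P> where "\<P> = (\<lambda>E. X interior_of (f ` E)) ` \<E> - {{}}"
  have "|\<P>| \<le>o |\<E>|"
    unfolding \<P>_def by (rule ordLeq_transitive[OF card_of_mono1[OF Diff_subset] card_of_image])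
  then have "|\<P>| <o pi_char p X"
    using assms(1) by (rule ordLeq_ordLess_trans)
  then have "\<not> pi_char p X \<le>o |\<P>|"
    by (rule not_ordLess_ordLeq)
  then have "\<not> local_pi_base X p \<P>"
    using pi_char_le[of X p \<P>] by blast
  \<comment> \<open>Members of \<open>\<P>\<close> are open and nonempty by construction, so only
    the neighbourhood clause of \<open>local_pi_base\<close> can fail.\<close>
  then obtain H where "openin X H" "p \<in> H" "\<forall>V\<in>\<P>. \<not> V \<subseteq> H"
    unfolding local_pi_base_def \<P>_def by auto
  then show thesis
    using assms(2,3) by (intro that[of "H \<inter> Q"]) (auto simp: avoiding_def \<P>_def)
qed

text \<open>The stage of the pair \<open>(P, Q)\<close>, where \<open>\<E>\<close> collects the cylinders of the earlier stages.\<close>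

lemma exists_stage:
  assumes small: "\<And>p. p \<in> topspace X \<Longrightarrow> |\<E>| <o pi_char p X"
    and \<A>: "is_base X \<A>" and Q: "openin X Q" "X closure_of P \<subseteq> Q"
  shows "\<exists>s N. finite s \<and> finite N \<and> X closure_of P \<subseteq> \<Union>N \<and>
     (\<forall>U\<in>N. U \<in> \<A> \<and> U \<noteq> {} \<and> U \<subseteq> Q \<and> (\<exists>H. separating s U H \<and> avoiding \<E> H))"
proof -
  define ok where "ok U \<longleftrightarrow> U \<in> \<A> \<and> U \<noteq> {} \<and> U \<subseteq> Q \<and>
      (\<exists>H s. finite s \<and> separating s U H \<and> avoiding \<E> H)" for U
  have nhd: "\<exists>U. p \<in> U \<and> ok U" if p: "p \<in> X closure_of P" for p
  proof -
    have "p \<in> topspace X" using p by (meson closure_of_subset_topspace subsetD)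
    then obtain H where H: "openin X H" "p \<in> H" "H \<subseteq> Q" "avoiding \<E> H"
      using avoiding_nhd[OF small Q(1)] p Q(2) by blast
    obtain G where G: "openin X G" "p \<in> G" "X closure_of G \<subseteq> H"
      using nhd_closed[OF H(1,2)] .
    obtain s where s: "finite s" "separating s (X closure_of G) H"
      using finite_separating[OF closedin_closure_of H(1) G(3)] .
    obtain U where U: "U \<in> \<A>" "p \<in> U" "U \<subseteq> G"
      using \<A> G unfolding is_base_iff by blast
    have "U \<subseteq> X closure_of G"
      using U(3) closure_of_subset[OF openin_subset[OF G(1)]] by (rule subset_trans)
    then have "separating s U H"
      using separating_mono[OF s(2) subset_refl] by blast
    moreover have "U \<subseteq> Q"
      using \<open>U \<subseteq> X closure_of G\<close> G(3) H(3) by blast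
    ultimately show ?thesis
      using U(1,2) H(4) s(1) unfolding ok_def by blast
  qed
  have "compactin X (X closure_of P)"
    using compact closedin_compact_space closedin_closure_of by blast
  obtain N where N: "finite N" "N \<subseteq> Collect ok" "X closure_of P \<subseteq> \<Union>N"
  proof -
    have "X closure_of P \<subseteq> \<Union>(Collect ok)" using nhd by blast
    moreover have "openin X U" if "U \<in> Collect ok" for U
      using that \<A> unfolding is_base_iff ok_def by simp
    ultimately show thesis
      using compactinD[OF \<open>compactin X (X closure_of P)\<close>, of "Collect ok"] that by metis
  qed
  have "\<forall>U. \<exists>H s. U \<in> N \<longrightarrow> finite s \<and> separating s U H \<and> avoiding \<E> H"
    using N(2) unfolding ok_def by blast
  then obtain H s where Hs: "\<And>U. U \<in> N \<Longrightarrow> finite (s U) \<and> separating (s U) U (H U) \<and> avoiding \<E> (H U)"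
    by metis
  \<comment> \<open>The coordinates chosen for the single \<open>U\<close> are merged into one
    finite set; enlarging \<open>s\<close> preserves separation.\<close>
  have "U \<in> \<A> \<and> U \<noteq> {} \<and> U \<subseteq> Q \<and> (\<exists>H. separating (\<Union>(s ` N)) U H \<and> avoiding \<E> H)"
    if U: "U \<in> N" for U
  proof -
    have "separating (\<Union>(s ` N)) U (H U)" "avoiding \<E> (H U)"
      using Hs[OF U] U by (auto intro: separating_mono[of "s U"])
    moreover have "ok U" using U N(2) by blast
    ultimately show ?thesis unfolding ok_def by blast
  qed
  then have members: "\<forall>U\<in>N. U \<in> \<A> \<and> U \<noteq> {} \<and> U \<subseteq> Q \<and>
      (\<exists>H. separating (\<Union>(s ` N)) U H \<and> avoiding \<E> H)"
    by (intro ballI)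
  have "finite (\<Union>(s ` N))"
    using N(1) Hs by simp
  then show ?thesis
    using N(1,3) members by (intro exI conjI)
qed

text \<open>Stages with a member above \<open>U\<close> are told apart by the trace of their
  coordinates on one finite set \<open>t\<close>.\<close>

lemma finite_cover_if_stages:
  assumes U: "openin X U" "U \<noteq> {}"
    and total: "\<And>i j. i \<in> J \<Longrightarrow> j \<in> J \<Longrightarrow> i \<noteq> j \<Longrightarrow> (i, j) \<in> R \<or> (j, i) \<in> R"
    and fin: "\<And>j. j \<in> J \<Longrightarrow> finite (N j)"
    and stage: "\<And>j V. j \<in> J \<Longrightarrow> V \<in> N j \<Longrightarrow>
      \<exists>H. separating (s j) V H \<and> avoiding (\<Union>i\<in>{i\<in>J. (i, j) \<in> R}. cylinders I (s i)) H"
  shows "finite {V \<in> \<Union>(N ` J). U \<subseteq> V}"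
proof -
  obtain t x where t: "finite t" "t \<subseteq> I" "f ` cylinder I t x \<subseteq> U"
      "X interior_of (f ` cylinder I t x) \<noteq> {}"
    using image_cylinder_with_interior[OF U] .
  define bad where "bad = {j \<in> J. \<exists>V\<in>N j. U \<subseteq> V}"
  \<comment> \<open>Forgetting coordinates enlarges the cylinder, so its image still has interior,
    yet that image lies in an \<open>H\<close> avoiding all earlier cylinders.\<close>
  have new: "cylinder I (t \<inter> s j) x \<notin> cylinders I (s i)"
    if ij: "j \<in> bad" "i \<in> J" "(i, j) \<in> R" for i j
  proof
    assume old: "cylinder I (t \<inter> s j) x \<in> cylinders I (s i)"
    obtain V where V: "V \<in> N j" "U \<subseteq> V" "j \<in> J"
      using ij(1) unfolding bad_def by blast
    then obtain H where H: "separating (s j) V H"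
        "avoiding (\<Union>i\<in>{i\<in>J. (i, j) \<in> R}. cylinders I (s i)) H"
      using stage by blast
    let ?E = "f ` cylinder I (t \<inter> s j) x"
    have "?E \<subseteq> H"
      using image_cylinder_Int_subset[OF H(1) t(2)] t(3) V(2) by blast
    then have "X interior_of ?E \<subseteq> H"
      using interior_of_subset by (metis subset_trans)
    moreover have "f ` cylinder I t x \<subseteq> ?E"
      by (auto simp: cylinder_def)
    then have "X interior_of ?E \<noteq> {}"
      using t(4) interior_of_mono by (metis subset_empty)
    ultimately show False
      using H(2) old ij(2,3) unfolding avoiding_def by blast
  qed
  have "inj_on (\<lambda>j. t \<inter> s j) bad"
  \<comment> \<open>With equal traces both stages own the same cylinder, so the later of the two
    contradicts \<open>new\<close>.\<close>
  proof (rule inj_onI, rule ccontr)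
    fix i j assume ij: "i \<in> bad" "j \<in> bad" "t \<inter> s i = t \<inter> s j" "i \<noteq> j"
    have "cylinder I (t \<inter> s i) x \<in> cylinders I (s i)" "cylinder I (t \<inter> s j) x \<in> cylinders I (s j)"
      by (auto simp: cylinders_def)
    then show False
      using new[of i j] new[of j i] ij total[of i j] by (auto simp: bad_def)
  qed
  moreover have "(\<lambda>j. t \<inter> s j) ` bad \<subseteq> Pow t" by blast
  ultimately have "finite bad"
    using t(1) by (meson finite_Pow_iff finite_imageD finite_subset)
  then have "finite (\<Union>(N ` bad))"
    using fin by (auto simp: bad_def)
  moreover have "{V \<in> \<Union>(N ` J). U \<subseteq> V} \<subseteq> \<Union>(N ` bad)"
    by (auto simp: bad_def)
  ultimately show ?thesis by (rule finite_subset[rotated])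
qed

section \<open>The recursion over pairs of base members\<close>

lemma omega_op_like_subbase_if_infinite_weight:
  assumes \<B>: "is_base X \<B>" "weight X = |\<B>|" "infinite \<B>"
    and pi: "\<And>p. p \<in> topspace X \<Longrightarrow> pi_char p X =o weight X"
    and \<A>: "is_base X \<A>"
  shows "\<exists>\<C>\<subseteq>\<A>. is_base X \<C> \<and> omega_op_like \<C>"
proof -
  define J where "J = {(P, Q). P \<in> \<B> \<and> Q \<in> \<B> \<and> X closure_of P \<subseteq> Q}"
  \<comment> \<open>The strict part of a cardinal well-order: each stage has fewer than
    \<open>|J|\<close> predecessors.\<close>
  define R where "R = |J| - Id"
  \<comment> \<open>\<open>r = (s, N)\<close> is an admissible choice at \<open>j\<close>, given the
    earlier choices \<open>F\<close>. Off \<open>J\<close> anything is admissible, so that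
    \<open>F\<close> can be total.\<close>
  define stage where "stage F j r \<longleftrightarrow> (j \<in> J \<longrightarrow> (case (j, r) of ((P, Q), (s, N)) \<Rightarrow>
      finite s \<and> finite N \<and> X closure_of P \<subseteq> \<Union>N \<and>
      (\<forall>U\<in>N. U \<in> \<A> \<and> U \<noteq> {} \<and> U \<subseteq> Q \<and> (\<exists>H. separating s U H \<and>
         avoiding (\<Union>i\<in>{i\<in>J. (i, j) \<in> R}. cylinders I (fst (F i))) H))))"
    for F :: "_ \<Rightarrow> 'i set \<times> 'a set set" and j r
  have wo: "well_order_on J |J|" by (rule card_of_well_order_on)
  have "wf R"
    using wo unfolding R_def well_order_on_def by blast
  have total: "(i, j) \<in> R \<or> (j, i) \<in> R" if "i \<in> J" "j \<in> J" "i \<noteq> j" for i j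
    using wo that unfolding R_def well_order_on_def linear_order_on_def total_on_def by blast
  have "|J| \<le>o |\<B> \<times> \<B>|"
    by (rule card_of_mono1) (auto simp: J_def)
  then have J_le: "|J| \<le>o |\<B>|"
    using card_of_Times_same_infinite[OF \<B>(3)] ordLeq_ordIso_trans by blast
  have "\<exists>F. \<forall>j. stage F j (F j)"
  proof (rule dependent_wf_choice[OF \<open>wf R\<close>])
    fix F G :: "'a set \<times> 'a set \<Rightarrow> 'i set \<times> 'a set set" and j r
    assume "\<And>i. (i, j) \<in> R \<Longrightarrow> F i = G i"
    then have "(\<Union>i\<in>{i\<in>J. (i, j) \<in> R}. cylinders I (fst (F i)))
        = (\<Union>i\<in>{i\<in>J. (i, j) \<in> R}. cylinders I (fst (G i)))"
      by auto
    then show "stage F j r = stage G j r" unfolding stage_def by simp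
  next
    fix j and F :: "'a set \<times> 'a set \<Rightarrow> 'i set \<times> 'a set set"
    assume prev: "\<And>i. (i, j) \<in> R \<Longrightarrow> stage F i (F i)"
    let ?J = "{i\<in>J. (i, j) \<in> R}"
    show "\<exists>r. stage F j r"
    proof (cases "j \<in> J")
      case True
      then obtain P Q where PQ: "j = (P, Q)" "Q \<in> \<B>" "X closure_of P \<subseteq> Q"
        by (auto simp: J_def)
      have "?J \<subseteq> underS |J| j" by (auto simp: R_def underS_def)
      then have "|?J| \<le>o |underS |J| j|" by (rule card_of_mono1)
      moreover have "|underS |J| j| <o |J|"
        using True by (intro card_of_underS card_of_Card_order) (simp add: Field_card_of)
      ultimately have "|?J| <o |J|" by (rule ordLeq_ordLess_trans)
      then have "|?J| <o |\<B>|" using J_le ordLess_ordLeq_trans by blast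
      moreover have "finite (cylinders I (fst (F i)))" if "i \<in> ?J" for i
        using prev[of i] that by (auto simp: stage_def finite_cylinders split: prod.splits)
      ultimately have "|\<Union>i\<in>?J. cylinders I (fst (F i))| <o |\<B>|"
        by (intro UN_finite_ordLess[OF \<B>(3)])
      then have "|\<Union>i\<in>?J. cylinders I (fst (F i))| <o pi_char p X" if "p \<in> topspace X" for p
        using ordLess_ordIso_trans[OF _ ordIso_symmetric[OF pi[OF that]]] \<B>(2) by simp
      moreover have "openin X Q" using \<B>(1) PQ(2) by (simp add: is_base_iff)
      ultimately obtain s N where "finite s \<and> finite N \<and> X closure_of P \<subseteq> \<Union>N \<and>
          (\<forall>U\<in>N. U \<in> \<A> \<and> U \<noteq> {} \<and> U \<subseteq> Q \<and> (\<exists>H. separating s U H \<and>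
             avoiding (\<Union>i\<in>?J. cylinders I (fst (F i))) H))"
        using exists_stage[OF _ \<A> _ PQ(3), of "\<Union>i\<in>?J. cylinders I (fst (F i))"]
        by (elim exE meta_impE)
      then have "stage F j (s, N)"
        unfolding stage_def PQ(1) prod.case by (rule impI)
      then show ?thesis by (rule exI)
    qed (auto simp: stage_def)
  qed
  then obtain F where F: "\<And>j. stage F j (F j)" by blast
  define s N where "s = fst \<circ> F" and "N = snd \<circ> F"
  have st: "finite (N (P, Q))" "X closure_of P \<subseteq> \<Union>(N (P, Q))"
      "\<And>U. U \<in> N (P, Q) \<Longrightarrow> U \<in> \<A> \<and> U \<noteq> {} \<and> U \<subseteq> Q \<and> (\<exists>H. separating (s (P, Q)) U H \<and>
         avoiding (\<Union>i\<in>{i\<in>J. (i, (P, Q)) \<in> R}. cylinders I (s i)) H)"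
    if "(P, Q) \<in> J" for P Q
    using F[of "(P, Q)"] that unfolding stage_def s_def N_def by (auto simp: case_prod_beta)
  let ?\<C> = "\<Union>(N ` J)"
  have sub: "?\<C> \<subseteq> \<A>" using st(3) by fastforce
  have op: "openin X U" if "U \<in> ?\<C>" for U
    using that sub \<A> unfolding is_base_iff by blast
  have ne: "U \<noteq> {}" if "U \<in> ?\<C>" for U
    using that st(3) by fastforce
  have "\<exists>V\<in>?\<C>. p \<in> V \<and> V \<subseteq> W" if W: "openin X W" "p \<in> W" for W p
  proof -
    \<comment> \<open>Regularity gives base members with \<open>p \<in> P\<close> and
      \<open>X closure_of P \<subseteq> Q \<subseteq> W\<close>; the cover chosen at
      \<open>(P, Q)\<close> then supplies \<open>V\<close>.\<close>
    obtain Q where Q: "Q \<in> \<B>" "p \<in> Q" "Q \<subseteq> W"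
      using \<B>(1) W unfolding is_base_iff by blast
    then obtain G where G: "openin X G" "p \<in> G" "X closure_of G \<subseteq> Q"
      using \<B>(1) nhd_closed unfolding is_base_iff by metis
    then obtain P where P: "P \<in> \<B>" "p \<in> P" "P \<subseteq> G"
      using \<B>(1) unfolding is_base_iff by blast
    have PQ: "(P, Q) \<in> J"
      using P Q G closure_of_mono[OF P(3), of X] by (auto simp: J_def)
    have "P \<subseteq> X closure_of P"
      using \<B>(1) P(1) closure_of_subset openin_subset unfolding is_base_iff by metis
    then obtain V where "V \<in> N (P, Q)" "p \<in> V"
      using st(2)[OF PQ] P(2) by blast
    then show ?thesis using st(3)[OF PQ] PQ Q(3) by blast
  qed
  then have "is_base X ?\<C>"
    using op unfolding is_base_iff by blast
  moreover have "finite {V \<in> ?\<C>. U \<subseteq> V}" if "U \<in> ?\<C>" for U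
  proof (rule finite_cover_if_stages[OF op[OF that] ne[OF that] total, where s = s])
    show "finite (N j)" if "j \<in> J" for j
      using st(1) that by (cases j) blast
    show "\<exists>H. separating (s j) V H \<and> avoiding (\<Union>i\<in>{i\<in>J. (i, j) \<in> R}. cylinders I (s i)) H"
      if "j \<in> J" "V \<in> N j" for j V
      using st(3) that by (cases j) blast
  qed
  ultimately show ?thesis
    using sub unfolding omega_op_like_def by blast
qed

end

theorem theorem3p26:
  fixes X :: "'a topology" and \<A> :: "'a set set"
  assumes "dyadic_compactum TYPE('i) X"
    and "\<forall>p\<in>topspace X. ordIso2 (pi_char p X) (weight X)"
    and "is_base X \<A>"
  shows "\<exists>\<B>\<subseteq>\<A>. is_base X \<B> \<and> omega_op_like \<B>"
proof -
  obtain I :: "'i set" and f where "cantor_cube_image X I f"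
    using assms(1) unfolding dyadic_compactum_def cantor_cube_image_def by blast
  then interpret cantor_cube_image X I f .
  obtain \<B> where \<B>: "is_base X \<B>" "weight X = |\<B>|"
    by (rule weight_attained)
  show ?thesis
  proof (cases "finite \<B>")
    case False
    then show ?thesis
      using omega_op_like_subbase_if_infinite_weight[OF \<B>] assms(2,3) by blast
  next
    case True
    \<comment> \<open>The cube is nonempty even for empty \<open>I\<close>, hence so is
      \<open>X\<close>. With finite weight its only nonempty open set is the whole space.\<close>
    obtain p where p: "p \<in> topspace X"
      using onto by (metis PiE_eq_empty_iff UNIV_not_empty equals0I image_is_empty topspace_cantor_cube)
    have triv: "U = topspace X" if "openin X U" "U \<noteq> {}" for U
      using trivial_if_finite_weight[OF \<B> True p] assms(2) p that by blast
    obtain V where "V \<in> \<A>" "p \<in> V" "openin X V"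
      using assms(3) p openin_topspace[of X] unfolding is_base_iff by blast
    then have "topspace X \<in> \<A>" using triv by blast
    moreover have "is_base X {topspace X}"
      using triv unfolding is_base_iff by blast
    ultimately show ?thesis
      by (intro exI[of _ "{topspace X}"]) (auto simp: omega_op_like_def)
  qed
qed

end
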